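(* For every integer $d\ge1$ there is a constant $C(d)$ such that for all $u\in C_c^\infty(\mathbb R^d,\mathbb R^d)$ $$\|Q_{\mathcal H(d)}(\nabla u)\|_{L^2(\mathbb R^d)}\le C(d)\,\|P_{\mathcal H(d)}(\nabla u)\|_{L^2(\mathbb R^d)}.$$
   Context: $M_d(\mathbb R)$ is the space of real $d\times d$ matrices with the Frobenius inner product $\langle A,B\rangle=\mathrm{Tr}(AB^t)$ and norm. $\mathcal H(d)\subset M_d(\mathbb R)$ is the subspace of Hankel matrices, i.e. matrices constant on each skew-diagonal ($A_{ij}$ depends only on $i+j$). $P_{\mathcal H(d)}$ and $Q_{\mathcal H(d)}$ are the orthogonal projections onto $\mathcal H(d)$ and $\mathcal H(d)^\perp$ respectively, applied pointwise. *)

theory Defs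
  imports "HOL-Analysis.Analysis"
begin

primrec C_diff :: "nat \<Rightarrow> ('a::real_normed_vector \<Rightarrow> 'b::real_normed_vector) \<Rightarrow> bool" where
  "C_diff 0 f \<longleftrightarrow> continuous_on UNIV f"
| "C_diff (Suc k) f \<longleftrightarrow>
     (\<forall>x. f differentiable (at x)) \<and> (\<forall>v. C_diff k (\<lambda>x. frechet_derivative f (at x) v))"

definition smooth_compact_support :: "('a::real_normed_vector \<Rightarrow> 'b::real_normed_vector) set" where
  "smooth_compact_support = {f. (\<forall>k. C_diff k f) \<and> compact (closure {x. f x \<noteq> 0})}"

text \<open>The inner product and norm of the type of real matrices are the Frobenius ones.\<close>

lemma inner_matrix_eq_trace:
  fixes A B :: "real^'n^'n"
  shows "A \<bullet> B = trace (A ** transpose B)"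
  by (simp add: inner_vec_def trace_def matrix_matrix_mult_def transpose_def)

text \<open>The index type \<open>'n\<close> carries no order or arithmetic; \<open>idx\<close> numbers the
  coordinates by \<open>1, ..., CARD('n)\<close>, so that index sums make sense.\<close>

definition hankel :: "('n::finite \<Rightarrow> nat) \<Rightarrow> (real^'n^'n) set" where
  "hankel idx = {A. \<forall>i j k l. idx i + idx j = idx k + idx l \<longrightarrow> A $ i $ j = A $ k $ l}"

definition orth_proj :: "'a::euclidean_space set \<Rightarrow> 'a \<Rightarrow> 'a" where
  "orth_proj S x = (THE y. y \<in> S \<and> x - y \<in> S\<^sup>\<bottom>)"

text \<open>Meaningful only for subspaces, where the description is well defined:\<close>

lemma orth_proj_ex1:
  fixes S :: "'a::euclidean_space set"
  assumes "subspace S"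
  shows "\<exists>!y. y \<in> S \<and> x - y \<in> S\<^sup>\<bottom>"
proof -
  have S: "span S = S" using assms by (simp add: span_eq_iff)
  obtain y z where yz: "y \<in> span S" "\<And>w. w \<in> span S \<Longrightarrow> orthogonal z w" "x = y + z"
    using orthogonal_subspace_decomp_exists[of S x] by blast
  have z: "z \<in> S\<^sup>\<bottom>"
    unfolding orthogonal_comp_def using yz(2) S by (simp add: orthogonal_commute)
  show ?thesis
  proof (rule ex1I[of _ y])
    show "y \<in> S \<and> x - y \<in> S\<^sup>\<bottom>" using yz(1,3) S z by simp
  next
    fix y' assume a: "y' \<in> S \<and> x - y' \<in> S\<^sup>\<bottom>"
    have "y' - y \<in> S" using a yz(1) S assms by (simp add: subspace_diff)
    moreover have "z - (x - y') \<in> S\<^sup>\<bottom>"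
      using subspace_diff[OF subspace_orthogonal_comp z] a by blast
    then have "y' - y \<in> S\<^sup>\<bottom>" using yz(3) by simp
    ultimately have "orthogonal (y' - y) (y' - y)"
      unfolding orthogonal_comp_def by blast
    then show "y' = y" by (simp add: orthogonal_def)
  qed
qed

lemma subspace_hankel: "subspace (hankel idx)"
proof (rule subspaceI)
  show "0 \<in> hankel idx" by (simp add: hankel_def)
next
  fix A B assume "A \<in> hankel idx" "B \<in> hankel idx"
  then have "A $ i $ j = A $ k $ l" "B $ i $ j = B $ k $ l"
    if "idx i + idx j = idx k + idx l" for i j k l
    using that unfolding hankel_def by blast+
  then show "A + B \<in> hankel idx"
    unfolding hankel_def mem_Collect_eq vector_add_component
    by (intro allI impI arg_cong2[where f="(+)"])
next
  fix c A assume "A \<in> hankel idx"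
  then have "A $ i $ j = A $ k $ l" if "idx i + idx j = idx k + idx l" for i j k l
    using that unfolding hankel_def by blast
  then show "c *\<^sub>R A \<in> hankel idx"
    unfolding hankel_def mem_Collect_eq vector_scaleR_component
    by (intro allI impI arg_cong[where f="scaleR c"])
qed

text \<open>The Bochner integral of a non-integrable function is 0, so this is the \<open>L\<^sup>2\<close> norm
  only for square-integrable \<open>f\<close>. It is applied below to continuous functions of compact
  support.\<close>

definition L2_norm :: "('a::euclidean_space \<Rightarrow> 'b::real_normed_vector) \<Rightarrow> real" where
  "L2_norm f = sqrt (LINT x|lborel. (norm (f x))\<^sup>2)"

end

theory Submission
  imports Defs
begin

text \<open>
  Write \<open>a(i, j)\<close> for the partial derivative of the \<open>i\<close>-th component of \<open>u\<close> in the \<open>j\<close>-th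
  direction. Orthogonality to the Hankel matrices means that all sums over skew-diagonals
  \<open>i + j = m\<close> vanish, so the Hankel part of the gradient controls the \<open>L\<^sup>2\<close> norms of the
  functions \<open>s(m)\<close>, the sum of \<open>a(i, j)\<close> over \<open>i + j = m\<close>
  (\<open>skew_sum_le_orth_proj_hankel\<close>). It has to be shown that these control the whole gradient.
  On the Fourier side \<open>a\<close> is a rank-one matrix and \<open>s(m)\<close> are the coefficients of a product of
  two polynomials, which vanishes only if a factor does. The proof below is an elementary
  quantitative form of the usual argument for this, comparing lowest coefficients first, and
  works directly with integrals.

  The only trace of rank one that is needed is that \<open>2 \<times> 2\<close> minors of a gradient
  integrate to zero: the integrals of \<open>a(i, j) a(k, l)\<close> and \<open>a(i, l) a(k, j)\<close> agree
  (\<open>integral_deriv_swap\<close>). Expand the integral of \<open>s(m)\<^sup>2\<close>. The diagonal terms are the energies of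
  the entries of the \<open>m\<close>-th skew-diagonal. For a cross term with \<open>(i, j) \<noteq> (k, l)\<close>,
  exchanging \<open>j\<close> and \<open>l\<close> produces two entries on skew-diagonals \<open>i + l\<close> and \<open>k + j\<close>, which
  differ from \<open>m\<close> and have mean \<open>m\<close>; one of them lies strictly below the \<open>m\<close>-th. By the
  weighted Cauchy-Schwarz inequality the cross term is at most a small multiple of the total
  energy plus a large multiple of an energy already estimated. Induction on \<open>m\<close>
  (\<open>skew_diagonal_estimate\<close>) bounds every entry by the Hankel part up to an arbitrarily small
  fraction of the total energy; summing over all entries, this fraction is absorbed
  (\<open>total_energy_estimate\<close>).
\<close>

section \<open>Energies on skew-diagonals\<close>

definition skew_diagonal :: "('n::finite \<Rightarrow> nat) \<Rightarrow> nat \<Rightarrow> ('n \<times> 'n) set" where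
  "skew_diagonal idx m = {(i, j). idx i + idx j = m}"

text \<open>
  The properties of the Gram matrix \<open>B\<close> of the entries of a gradient that the induction uses.
  The first clause expresses that minors integrate to zero; the second is the
  Cauchy-Schwarz inequality in additive form; the last one bounds the squared norms of the
  sums over skew-diagonals by \<open>S\<close>. Working with an abstract \<open>B\<close> makes it evident that the
  resulting constants depend neither on the vector field nor on the numbering.
\<close>

definition skew_controlled ::
    "('n::finite \<Rightarrow> nat) \<Rightarrow> ('n \<times> 'n \<Rightarrow> 'n \<times> 'n \<Rightarrow> real) \<Rightarrow> real \<Rightarrow> bool" where
  "skew_controlled idx B S \<longleftrightarrow>
     (\<forall>i j k l. B (i, j) (k, l) = B (i, l) (k, j)) \<and>
     (\<forall>p q \<delta>. 0 < \<delta> \<longrightarrow> \<bar>B p q\<bar> \<le> \<delta> * B p p + B q q / \<delta>) \<and>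
     (\<forall>p. 0 \<le> B p p) \<and> 0 \<le> S \<and>
     (\<forall>m. (\<Sum>p\<in>skew_diagonal idx m. \<Sum>q\<in>skew_diagonal idx m. B p q) \<le> S)"

text \<open>
  Two distinct entries of one skew-diagonal lie in different columns, so exchanging their
  columns moves one of them to a lower skew-diagonal. That entry receives the large weight
  \<open>1 / \<delta>\<close> in the Cauchy-Schwarz inequality.
\<close>

lemma cross_term_bound:
  assumes inj: "inj idx" and B: "skew_controlled idx B S"
    and pq: "p \<in> skew_diagonal idx m" "q \<in> skew_diagonal idx m" "p \<noteq> q"
    and low: "\<And>i j. idx i + idx j < m \<Longrightarrow> B (i, j) (i, j) \<le> K"
    and \<delta>: "0 < \<delta>"
  shows "\<bar>B p q\<bar> \<le> \<delta> * (\<Sum>p\<in>UNIV. B p p) + K / \<delta>"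
proof -
  obtain i j k l where ij: "p = (i, j)" "q = (k, l)" by fastforce
  have m: "idx i + idx j = m" "idx k + idx l = m"
    using pq ij by (auto simp: skew_diagonal_def)
  have swap: "B (i, j) (k, l) = B (i, l) (k, j)"
    and CS: "\<And>p q \<delta>. 0 < \<delta> \<Longrightarrow> \<bar>B p q\<bar> \<le> \<delta> * B p p + B q q / \<delta>"
    and nn: "\<And>p. 0 \<le> B p p"
    using B unfolding skew_controlled_def by blast+
  have le: "B r r \<le> (\<Sum>p\<in>UNIV. B p p)" for r
    by (rule member_le_sum) (auto simp: nn)
  have "idx j \<noteq> idx l"
  proof
    assume "idx j = idx l"
    then have "idx i = idx k" using m by simp
    then show False using \<open>idx j = idx l\<close> inj pq(3) ij by (auto dest: injD)
  qed
  then consider "idx k + idx j < m" | "idx i + idx l < m" using m by linarith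
  then show ?thesis
  proof cases
    case 1
    have "\<bar>B p q\<bar> \<le> \<delta> * B (i, l) (i, l) + B (k, j) (k, j) / \<delta>"
      using CS[OF \<delta>] swap ij by simp
    also have "\<dots> \<le> \<delta> * (\<Sum>p\<in>UNIV. B p p) + K / \<delta>"
      using \<delta> low[OF 1] le by (intro add_mono mult_left_mono divide_right_mono) auto
    finally show ?thesis .
  next
    case 2
    have "\<bar>B p q\<bar> \<le> (1/\<delta>) * B (i, l) (i, l) + B (k, j) (k, j) / (1/\<delta>)"
      using CS[of "1/\<delta>" "(i, l)" "(k, j)"] \<delta> swap ij by simp
    also have "\<dots> = \<delta> * B (k, j) (k, j) + B (i, l) (i, l) / \<delta>" by simp
    also have "\<dots> \<le> \<delta> * (\<Sum>p\<in>UNIV. B p p) + K / \<delta>"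
      using \<delta> low[OF 2] le by (intro add_mono mult_left_mono divide_right_mono) auto
    finally show ?thesis .
  qed
qed

text \<open>
  Separating diagonal and cross terms in the squared norm of the sum over the \<open>m\<close>-th
  skew-diagonal; the number of cross terms is estimated crudely.
\<close>

lemma skew_diagonal_step:
  fixes idx :: "'n::finite \<Rightarrow> nat"
  assumes inj: "inj idx" and B: "skew_controlled idx B S"
    and low: "\<And>i j. idx i + idx j < m \<Longrightarrow> B (i, j) (i, j) \<le> K" and K: "0 \<le> K"
    and \<delta>: "0 < \<delta>" and ij: "idx i + idx j = m"
  shows "B (i, j) (i, j) \<le> S + (real CARD('n \<times> 'n))\<^sup>2 * (\<delta> * (\<Sum>p\<in>UNIV. B p p) + K / \<delta>)"
proof -
  let ?D = "skew_diagonal idx m" and ?N = "real CARD('n \<times> 'n)"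
  let ?b = "\<delta> * (\<Sum>p\<in>UNIV. B p p) + K / \<delta>"
  have nn: "\<And>p. 0 \<le> B p p" and S: "(\<Sum>p\<in>?D. \<Sum>q\<in>?D. B p q) \<le> S"
    using B unfolding skew_controlled_def by blast+
  have b: "0 \<le> ?b" using \<delta> K by (simp add: sum_nonneg nn)
  have card: "real (card A) \<le> ?N" for A :: "('n \<times> 'n) set"
    by (rule of_nat_mono[OF card_mono]) auto
  have "B (i, j) (i, j) \<le> (\<Sum>p\<in>?D. B p p)"
    by (rule member_le_sum) (use ij nn in \<open>auto simp: skew_diagonal_def\<close>)
  moreover have "(\<Sum>p\<in>?D. \<Sum>q\<in>?D. B p q) = (\<Sum>p\<in>?D. B p p) + (\<Sum>p\<in>?D. \<Sum>q\<in>?D - {p}. B p q)"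
    by (simp add: sum.distrib[symmetric] sum.remove cong: sum.cong)
  moreover have "- (\<Sum>p\<in>?D. \<Sum>q\<in>?D - {p}. B p q) \<le> (\<Sum>p\<in>?D. \<Sum>q\<in>?D - {p}. ?b)"
    unfolding sum_negf[symmetric]
  proof (intro sum_mono)
    fix p q assume "p \<in> ?D" "q \<in> ?D - {p}"
    then show "- B p q \<le> ?b"
      using cross_term_bound[OF inj B, of p m q K \<delta>] low \<delta> by force
  qed
  moreover have "(\<Sum>p\<in>?D. \<Sum>q\<in>?D - {p}. ?b) \<le> (\<Sum>p\<in>?D. ?N * ?b)"
    by (intro sum_mono) (simp only: sum_constant mult_right_mono[OF card b])
  moreover have "(\<Sum>p\<in>?D. ?N * ?b) \<le> ?N * (?N * ?b)"
    unfolding sum_constant by (intro mult_right_mono card mult_nonneg_nonneg b) auto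
  ultimately show ?thesis using S unfolding power2_eq_square mult.assoc by linarith
qed

text \<open>
  The quantifier over \<open>\<epsilon>\<close> is part of the induction: the error allowed below level \<open>m\<close> gets
  multiplied by \<open>1 / \<delta>\<close> in the step, hence has to be chosen after \<open>\<delta>\<close>.
\<close>

lemma skew_diagonal_estimate:
  assumes "0 < (\<epsilon>::real)"
  shows "\<exists>C\<ge>0. \<forall>(idx::'n::finite \<Rightarrow> nat) B S. inj idx \<longrightarrow> skew_controlled idx B S \<longrightarrow>
           (\<forall>i j. idx i + idx j < m \<longrightarrow> B (i, j) (i, j) \<le> C * S + \<epsilon> * (\<Sum>p\<in>UNIV. B p p))"
  using assms
proof (induction m arbitrary: \<epsilon>)
  case 0
  show ?case by (rule exI[of _ 0]) auto
next
  case (Suc m)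
  let ?N = "(real CARD('n \<times> 'n))\<^sup>2"
  have "1 \<le> real CARD('n \<times> 'n)"
    using zero_less_card_finite[where 'a="'n \<times> 'n"] by linarith
  then have N: "1 \<le> ?N" by (rule one_le_power)
  \<comment> \<open>Both \<open>?N * \<delta>\<close> and \<open>?N * \<eta> / \<delta>\<close> are at most \<open>\<epsilon> / 2\<close>; the minimum with \<open>\<epsilon>\<close> serves
    the entries below level \<open>m\<close>.\<close>
  define \<delta> where "\<delta> = \<epsilon> / (2 * ?N)"
  define \<eta> where "\<eta> = min \<epsilon> (\<delta> * \<epsilon> / (2 * ?N))"
  have \<delta>: "0 < \<delta>" unfolding \<delta>_def using Suc.prems N by simp
  have \<eta>: "0 < \<eta>" unfolding \<eta>_def using Suc.prems \<delta> N by simp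
  obtain C where C: "0 \<le> C" and IH: "\<And>(idx::'n \<Rightarrow> nat) B S i j. inj idx \<Longrightarrow> skew_controlled idx B S \<Longrightarrow>
      idx i + idx j < m \<Longrightarrow> B (i, j) (i, j) \<le> C * S + \<eta> * (\<Sum>p\<in>UNIV. B p p)"
    using Suc.IH[OF \<eta>] by blast
  let ?C = "1 + C + ?N * (C / \<delta>)"
  have "B (i, j) (i, j) \<le> ?C * S + \<epsilon> * (\<Sum>p\<in>UNIV. B p p)"
    if inj: "inj idx" and B: "skew_controlled idx B S" and ij: "idx i + idx j < Suc m"
    for idx :: "'n \<Rightarrow> nat" and B S i j
  proof -
    let ?G = "\<Sum>p\<in>UNIV. B p p"
    have S: "0 \<le> S" and G: "0 \<le> ?G"
      using B unfolding skew_controlled_def by (auto intro!: sum_nonneg)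
    show ?thesis
    proof (cases "idx i + idx j < m")
      case True
      have "C * S \<le> ?C * S" using C S \<delta> by (intro mult_right_mono) auto
      moreover have "\<eta> * ?G \<le> \<epsilon> * ?G" using G by (intro mult_right_mono) (auto simp: \<eta>_def)
      ultimately show ?thesis using IH[OF inj B True] by linarith
    next
      case False
      then have "idx i + idx j = m" using ij by simp
      then have "B (i, j) (i, j) \<le> S + ?N * (\<delta> * ?G + (C * S + \<eta> * ?G) / \<delta>)"
        using skew_diagonal_step[OF inj B, of m "C * S + \<eta> * ?G" \<delta> i j] IH[OF inj B]
          \<delta> \<eta> C S G by simp
      also have "\<dots> = (1 + ?N * (C / \<delta>)) * S + (?N * \<delta> + ?N * \<eta> / \<delta>) * ?G"
        using \<delta> by (simp add: field_simps)
      also have "\<dots> \<le> ?C * S + \<epsilon> * ?G"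
      proof (intro add_mono mult_right_mono S G)
        have "?N * \<delta> = \<epsilon> / 2" unfolding \<delta>_def using N by simp
        moreover have "\<eta> * (2 * ?N) \<le> \<delta> * \<epsilon>"
          using N unfolding \<eta>_def by (simp add: min_def field_simps)
        then have "?N * \<eta> / \<delta> \<le> \<epsilon> / 2" using \<delta> by (simp add: field_simps)
        ultimately show "?N * \<delta> + ?N * \<eta> / \<delta> \<le> \<epsilon>" by linarith
      qed (use C \<delta> in auto)
      finally show ?thesis .
    qed
  qed
  moreover have "0 \<le> ?C" using C \<delta> by simp
  ultimately show ?case by (intro exI[of _ ?C] conjI allI impI)
qed

text \<open>
  All entries lie on skew-diagonals up to \<open>2 * CARD('n)\<close>. Allowing each of them the fraction
  \<open>1 / (2 * CARD('n \<times> 'n))\<close> of the total energy adds up to one half, which is absorbed.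
\<close>

lemma total_energy_estimate:
  "\<exists>C\<ge>0. \<forall>(idx::'n::finite \<Rightarrow> nat) B S. bij_betw idx UNIV {1..CARD('n)} \<longrightarrow>
     skew_controlled idx B S \<longrightarrow> (\<Sum>p\<in>UNIV. B p p) \<le> C * S"
proof -
  let ?N = "real CARD('n \<times> 'n)"
  have N: "0 < ?N" by simp
  then have "0 < 1 / (2 * ?N)" by simp
  then obtain C where C: "0 \<le> C \<and> (\<forall>(idx::'n \<Rightarrow> nat) B S. inj idx \<longrightarrow> skew_controlled idx B S \<longrightarrow>
      (\<forall>i j. idx i + idx j < Suc (2 * CARD('n)) \<longrightarrow>
         B (i, j) (i, j) \<le> C * S + 1 / (2 * ?N) * (\<Sum>p\<in>UNIV. B p p)))"
    by (rule exE[OF skew_diagonal_estimate])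
  note est = conjunct2[OF C, rule_format]
  have total: "(\<Sum>p\<in>UNIV. B p p) \<le> (2 * ?N * C) * S"
    if bij: "bij_betw idx UNIV {1..CARD('n)}" and B: "skew_controlled idx B S"
    for idx :: "'n \<Rightarrow> nat" and B S
  proof -
    let ?G = "\<Sum>p\<in>UNIV. B p p"
    have le: "idx i \<le> CARD('n)" for i using bij_betwE[OF bij] by force
    have "?G \<le> (\<Sum>p\<in>(UNIV::('n\<times>'n) set). C * S + 1 / (2 * ?N) * ?G)"
    proof (intro sum_mono)
      fix p :: "'n \<times> 'n"
      obtain i j where p: "p = (i, j)" by fastforce
      have "idx i + idx j < Suc (2 * CARD('n))" using le[of i] le[of j] by simp
      then show "B p p \<le> C * S + 1 / (2 * ?N) * ?G"
        unfolding p by (rule est[OF bij_betw_imp_inj_on[OF bij] B])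
    qed
    also have "\<dots> = ?N * (C * S + 1 / (2 * ?N) * ?G)" by (simp only: sum_constant)
    also have "\<dots> = ?N * C * S + ?G / 2" using N by (simp add: distrib_left del: card_prod)
    finally show ?thesis by linarith
  qed
  show ?thesis
  proof (intro exI[of _ "2 * ?N * C"] conjI allI impI)
    show "0 \<le> 2 * ?N * C" using conjunct1[OF C] by simp
  qed (rule total)
qed

section \<open>Exchanging two partial derivatives under the integral\<close>

lemma integrable_continuous_bounded_support:
  fixes f :: "'a::euclidean_space \<Rightarrow> real"
  assumes "continuous_on UNIV f" "bounded {x. f x \<noteq> 0}"
  shows "integrable lborel f"
proof -
  obtain R where R: "{x. f x \<noteq> 0} \<subseteq> cball 0 R"
    using assms(2) unfolding bounded_iff subset_iff mem_cball_0 by blast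
  have "integrable lborel (\<lambda>x. indicator (cball 0 R) x *\<^sub>R f x)"
    by (rule borel_integrable_compact) (auto intro: continuous_on_subset[OF assms(1)])
  also have "(\<lambda>x. indicator (cball 0 R) x *\<^sub>R f x) = f"
  proof
    fix x
    show "indicator (cball 0 R) x *\<^sub>R f x = f x"
      using R by (cases "f x = 0") (auto simp: indicator_def subset_iff)
  qed
  finally show ?thesis .
qed

lemma integral_translation:
  fixes f :: "'a::euclidean_space \<Rightarrow> real"
  assumes "continuous_on UNIV f"
  shows "(\<integral>x. f (c + x) \<partial>lborel) = (\<integral>x. f x \<partial>lborel)"
proof -
  have "(\<integral>x. f x \<partial>distr lborel borel ((+) c)) = (\<integral>x. f (c + x) \<partial>lborel)"
    by (rule integral_distr) (use borel_measurable_continuous_onI[OF assms] in auto)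
  then show ?thesis unfolding lborel_distr_plus by (rule sym)
qed

text \<open>
  The discrete form of \<open>integral_deriv_swap\<close>. The adjoint of the translation by \<open>a\<close> is the
  translation by \<open>- a\<close>, so moving each translation to the other factor exchanges the two
  directions and reverses them.
\<close>

lemma integral_increments_swap:
  fixes f g :: "'a::euclidean_space \<Rightarrow> real"
  assumes f: "continuous_on UNIV f" "bounded {x. f x \<noteq> 0}"
    and g: "continuous_on UNIV g" "bounded {x. g x \<noteq> 0}"
  shows "(\<integral>x. (f (x + a) - f x) * (g (x + b) - g x) \<partial>lborel)
       = (\<integral>x. (f (x - b) - f x) * (g (x - a) - g x) \<partial>lborel)"
proof -
  have cont: "continuous_on UNIV (\<lambda>x. f (x + a) * g (x + b))" for a b
    by (intro continuous_intros continuous_on_compose2[OF f(1)] continuous_on_compose2[OF g(1)]) auto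
  have int: "integrable lborel (\<lambda>x. f (x + a) * g (x + b))" for a b
  proof (rule integrable_continuous_bounded_support[OF cont])
    have "{x. f (x + a) * g (x + b) \<noteq> 0} \<subseteq> (\<lambda>y. - a + y) ` {x. f x \<noteq> 0}"
      by (auto intro!: rev_image_eqI)
    then show "bounded {x. f (x + a) * g (x + b) \<noteq> 0}"
      using bounded_translation[OF f(2)] bounded_subset by blast
  qed
  define I where "I a b = (\<integral>x. f (x + a) * g (x + b) \<partial>lborel)" for a b
  have I: "I a b = I (a + c) (b + c)" for a b c
  proof -
    have "(\<lambda>x. f (x + (a + c)) * g (x + (b + c))) = (\<lambda>x. f ((c + x) + a) * g ((c + x) + b))"
      by (rule ext) (simp add: ac_simps)
    then show ?thesis
      unfolding I_def by (simp only: integral_translation[OF cont[of a b], of c])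
  qed
  have expand: "(\<integral>x. (f (x + a) - f x) * (g (x + b) - g x) \<partial>lborel) = I a b - I a 0 - I 0 b + I 0 0" for a b
  proof -
    have "(\<lambda>x. (f (x + a) - f x) * (g (x + b) - g x)) =
      (\<lambda>x. f (x + a) * g (x + b) - f (x + a) * g (x + 0) - f (x + 0) * g (x + b) + f (x + 0) * g (x + 0))"
      by (rule ext) (simp add: algebra_simps)
    then show ?thesis
      unfolding I_def by (simp only: Bochner_Integration.integral_add Bochner_Integration.integral_diff
        Bochner_Integration.integrable_diff int)
  qed
  have "I a b = I (-b) (-a)" "I a 0 = I 0 (-a)" "I 0 b = I (-b) 0"
    using I[of a b "-a-b"] I[of a 0 "-a"] I[of 0 b "-b"] by simp_all
  then have "I a b - I a 0 - I 0 b + I 0 0 = I (-b) (-a) - I (-b) 0 - I 0 (-a) + I 0 0"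
    by linarith
  then show ?thesis
    using expand[of a b] expand[of "-b" "-a"] unfolding add_uminus_conv_diff by linarith
qed

text \<open>
  The derivative is an argument so that it can be given as the component of the derivative of
  a vector field.
\<close>

definition C1_compact :: "('a::euclidean_space \<Rightarrow> real) \<Rightarrow> ('a \<Rightarrow> 'a \<Rightarrow> real) \<Rightarrow> bool" where
  "C1_compact f f' \<longleftrightarrow> (\<forall>x. (f has_derivative f' x) (at x)) \<and>
     (\<forall>v. continuous_on UNIV (\<lambda>x. f' x v)) \<and> bounded {x. f x \<noteq> 0}"

lemma C1_compact_continuous: "C1_compact f f' \<Longrightarrow> continuous_on UNIV f"
  unfolding C1_compact_def
  by (intro continuous_at_imp_continuous_on ballI has_derivative_continuous) blast

lemma C1_compact_deriv_bounded_support: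
  assumes "C1_compact f f'"
  shows "bounded {x. f' x v \<noteq> 0}"
proof -
  let ?K = "closure {x. f x \<noteq> 0}"
  have "f' x v = 0" if "x \<notin> ?K" for x
  proof -
    have "(f has_derivative f' x) (at x)" using assms unfolding C1_compact_def by blast
    moreover have "(f has_derivative (\<lambda>_. 0)) (at x)"
    proof (rule has_derivative_transform_within_open[of "\<lambda>_. 0" _ x UNIV "- ?K"])
      show "0 = f y" if "y \<in> - ?K" for y using that closure_subset[of "{x. f x \<noteq> 0}"] by auto
    qed (use that in auto)
    ultimately have "f' x = (\<lambda>_. 0)" by (rule has_derivative_unique)
    then show ?thesis by simp
  qed
  then have "{x. f' x v \<noteq> 0} \<subseteq> ?K" by blast
  moreover have "bounded ?K" using assms unfolding C1_compact_def by auto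
  ultimately show ?thesis by (rule bounded_subset[rotated])
qed

lemma C1_compact_deriv_bounded:
  assumes "C1_compact f f'"
  shows "\<exists>L\<ge>0. \<forall>x. \<bar>f' x v\<bar> \<le> L"
proof -
  obtain R where R: "{x. f' x v \<noteq> 0} \<subseteq> cball 0 R"
    using C1_compact_deriv_bounded_support[OF assms] unfolding bounded_iff subset_iff mem_cball_0
    by blast
  have "compact ((\<lambda>x. f' x v) ` cball 0 R)"
    using assms unfolding C1_compact_def
    by (intro compact_continuous_image) (auto intro: continuous_on_subset)
  then have "bounded ((\<lambda>x. f' x v) ` cball 0 R)" by (rule compact_imp_bounded)
  then obtain L where L: "0 < L" "\<And>x. x \<in> cball 0 R \<Longrightarrow> \<bar>f' x v\<bar> \<le> L"
    unfolding bounded_pos by auto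
  then have "\<bar>f' x v\<bar> \<le> L" for x
    using R L(1) L(2)[of x] by (cases "f' x v = 0") (auto simp: subset_iff)
  then show ?thesis using L(1) by (intro exI[of _ L]) auto
qed

definition diff_quotient :: "('a::real_vector \<Rightarrow> real) \<Rightarrow> 'a \<Rightarrow> nat \<Rightarrow> 'a \<Rightarrow> real" where
  "diff_quotient f v n x = (f (x + (1 / real (Suc n)) *\<^sub>R v) - f x) * real (Suc n)"

lemma C1_compact_line:
  assumes "C1_compact f f'"
  shows "((\<lambda>t. f (x + t *\<^sub>R v)) has_real_derivative f' (x + t *\<^sub>R v) v) (at t)"
proof -
  have f: "(f has_derivative f' y) (at y)" for y using assms unfolding C1_compact_def by blast
  have "((\<lambda>t. f (x + t *\<^sub>R v)) has_derivative (\<lambda>s. f' (x + t *\<^sub>R v) (s *\<^sub>R v))) (at t)"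
    by (rule has_derivative_compose[OF _ f]) (auto intro!: derivative_eq_intros)
  moreover have "f' y (s *\<^sub>R v) = f' y v * s" for s y
    using linear_scale[OF has_derivative_linear[OF f]] by simp
  ultimately show ?thesis unfolding has_field_derivative_def by simp
qed

lemma diff_quotient_bound:
  assumes "C1_compact f f'" "\<And>x. \<bar>f' x v\<bar> \<le> L"
  shows "\<bar>diff_quotient f v n x\<bar> \<le> L"
proof -
  obtain z where "f (x + (1 / real (Suc n)) *\<^sub>R v) - f (x + 0 *\<^sub>R v)
      = (1 / real (Suc n) - 0) * f' (x + z *\<^sub>R v) v"
    using MVT2[of 0 "1 / real (Suc n)" "\<lambda>t. f (x + t *\<^sub>R v)" "\<lambda>t. f' (x + t *\<^sub>R v) v"]
      C1_compact_line[OF assms(1)] by auto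
  then have "diff_quotient f v n x = f' (x + z *\<^sub>R v) v"
    unfolding diff_quotient_def by simp
  then show ?thesis using assms(2) by simp
qed

lemma diff_quotient_tendsto:
  assumes "C1_compact f f'"
  shows "(\<lambda>n. diff_quotient f v n x) \<longlonglongrightarrow> f' x v"
proof -
  have "((\<lambda>h. (f (x + h *\<^sub>R v) - f x) / h) \<longlongrightarrow> f' x v) (at 0)"
    using C1_compact_line[OF assms, of x v 0] unfolding DERIV_def by simp
  moreover have "filterlim (\<lambda>n. 1 / real (Suc n)) (at 0) sequentially"
    unfolding filterlim_at using LIMSEQ_inverse_real_of_nat by (auto simp: inverse_eq_divide)
  ultimately have "(\<lambda>n. (f (x + (1 / real (Suc n)) *\<^sub>R v) - f x) / (1 / real (Suc n))) \<longlonglongrightarrow> f' x v"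
    by (rule filterlim_compose)
  then show ?thesis by (simp add: diff_quotient_def)
qed

text \<open>
  Dominated convergence: by the mean value theorem the quotients are bounded by the suprema of
  the derivatives, and as the steps have length at most \<open>norm v\<close>, the products vanish outside
  one ball for all \<open>n\<close>.
\<close>

lemma integral_diff_quotients_tendsto:
  assumes f: "C1_compact f f'" and g: "C1_compact g g'"
  shows "(\<lambda>n. \<integral>x. diff_quotient f v n x * diff_quotient g w n x \<partial>lborel)
           \<longlonglongrightarrow> (\<integral>x. f' x v * g' x w \<partial>lborel)"
proof -
  obtain L where L: "0 \<le> L" "\<And>x. \<bar>f' x v\<bar> \<le> L" using C1_compact_deriv_bounded[OF f] by blast
  obtain M where M: "0 \<le> M" "\<And>x. \<bar>g' x w\<bar> \<le> M" using C1_compact_deriv_bounded[OF g] by blast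
  obtain R where R: "\<And>x. f x \<noteq> 0 \<Longrightarrow> norm x \<le> R"
    using f unfolding C1_compact_def bounded_iff by blast
  let ?K = "cball (0::'a) (R + norm v)"
  note [measurable] = borel_measurable_continuous_onI[OF C1_compact_continuous[OF f]]
    borel_measurable_continuous_onI[OF C1_compact_continuous[OF g]]
  have meas: "(\<lambda>x. f' x v) \<in> borel_measurable borel" "(\<lambda>x. g' x w) \<in> borel_measurable borel"
    using f g unfolding C1_compact_def by (auto intro: borel_measurable_continuous_onI)
  have zero: "diff_quotient f v n x = 0" if "x \<notin> ?K" for n x
  proof -
    have "norm ((1 / real (Suc n)) *\<^sub>R v) \<le> norm v" by (simp add: field_simps)
    moreover have "norm x \<le> norm (x + (1 / real (Suc n)) *\<^sub>R v) + norm ((1 / real (Suc n)) *\<^sub>R v)"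
      by (metis add_diff_cancel_right' norm_triangle_ineq4)
    ultimately have "R < norm (x + (1 / real (Suc n)) *\<^sub>R v)" using that by simp
    moreover have "R < norm x" using that norm_ge_zero[of v] unfolding mem_cball_0 by linarith
    ultimately show ?thesis unfolding diff_quotient_def using R[of x] R[of "x + (1 / real (Suc n)) *\<^sub>R v"] by force
  qed
  show ?thesis
  proof (rule integral_dominated_convergence[where w = "\<lambda>x. indicator ?K x *\<^sub>R (L * M)"])
    show "integrable lborel (\<lambda>x. indicator ?K x *\<^sub>R (L * M))"
      by (rule borel_integrable_compact) auto
    show "AE x in lborel. norm (diff_quotient f v n x * diff_quotient g w n x) \<le> indicator ?K x *\<^sub>R (L * M)" for n
    proof (rule AE_I2)
      fix x
      show "norm (diff_quotient f v n x * diff_quotient g w n x) \<le> indicator ?K x *\<^sub>R (L * M)"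
        using zero[of x n] diff_quotient_bound[OF f L(2), of n x] diff_quotient_bound[OF g M(2), of n x] L(1)
        by (cases "x \<in> ?K") (auto simp: abs_mult intro!: mult_mono)
    qed
    show "AE x in lborel. (\<lambda>n. diff_quotient f v n x * diff_quotient g w n x) \<longlonglongrightarrow> f' x v * g' x w"
      by (intro AE_I2 tendsto_mult diff_quotient_tendsto f g)
    show "(\<lambda>x. diff_quotient f v n x * diff_quotient g w n x) \<in> borel_measurable lborel" for n
      unfolding diff_quotient_def by measurable
    show "(\<lambda>x. f' x v * g' x w) \<in> borel_measurable lborel"
      using meas by simp
  qed
qed

text \<open>
  For twice differentiable functions this is integration by parts together with the symmetry
  of second derivatives. Passing to the limit in the discrete identity uses first derivatives
  only; the two sign changes from reversing both directions cancel.
\<close>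

lemma integral_deriv_swap:
  assumes f: "C1_compact f f'" and g: "C1_compact g g'"
  shows "(\<integral>x. f' x v * g' x w \<partial>lborel) = (\<integral>x. f' x w * g' x v \<partial>lborel)"
proof -
  have supp: "bounded {x. f x \<noteq> 0}" "bounded {x. g x \<noteq> 0}"
    using f g unfolding C1_compact_def by blast+
  have eq: "(\<integral>x. diff_quotient f v n x * diff_quotient g w n x \<partial>lborel)
      = (\<integral>x. diff_quotient f (-w) n x * diff_quotient g (-v) n x \<partial>lborel)" for n
  proof -
    have "(\<integral>x. diff_quotient f a n x * diff_quotient g b n x \<partial>lborel) = (real (Suc n))\<^sup>2 *
       (\<integral>x. (f (x + (1 / real (Suc n)) *\<^sub>R a) - f x) * (g (x + (1 / real (Suc n)) *\<^sub>R b) - g x) \<partial>lborel)" for a b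
      unfolding diff_quotient_def integral_mult_right_zero[symmetric]
      by (rule Bochner_Integration.integral_cong) (auto simp: power2_eq_square)
    then show ?thesis
      using integral_increments_swap[OF C1_compact_continuous[OF f] supp(1) C1_compact_continuous[OF g] supp(2)]
      by simp
  qed
  have neg: "f' x (-w) * g' x (-v) = f' x w * g' x v" for x
  proof -
    have "linear (f' x)" "linear (g' x)"
      using f g unfolding C1_compact_def by (auto intro: has_derivative_linear)
    then show ?thesis by (simp add: linear_neg)
  qed
  have "(\<lambda>n. \<integral>x. diff_quotient f v n x * diff_quotient g w n x \<partial>lborel)
      \<longlonglongrightarrow> (\<integral>x. f' x w * g' x v \<partial>lborel)"
    using integral_diff_quotients_tendsto[OF f g, of "-w" "-v"] unfolding neg eq .
  then show ?thesis
    using integral_diff_quotients_tendsto[OF f g] LIMSEQ_unique by blast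
qed

section \<open>The estimate for gradients\<close>

lemma orth_proj_in: "subspace S \<Longrightarrow> orth_proj S x \<in> S"
  and orth_proj_diff: "subspace S \<Longrightarrow> x - orth_proj S x \<in> S\<^sup>\<bottom>"
  unfolding orth_proj_def using theI'[OF orth_proj_ex1, of S x] by auto

lemma inner_orth_proj:
  assumes "subspace S" "y \<in> S"
  shows "orth_proj S x \<bullet> y = x \<bullet> y"
  using orth_proj_diff[OF assms(1), of x] assms(2)
  by (auto simp: orthogonal_comp_def orthogonal_def inner_diff_right inner_commute)

lemma norm_orth_proj_le:
  assumes "subspace S"
  shows "norm (orth_proj S x) \<le> norm x"
proof -
  have "(norm (orth_proj S x))\<^sup>2 = x \<bullet> orth_proj S x"
    using inner_orth_proj[OF assms orth_proj_in[OF assms]] by (simp add: power2_norm_eq_inner)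
  also have "\<dots> \<le> norm x * norm (orth_proj S x)" by (rule norm_cauchy_schwarz)
  finally show ?thesis by (simp add: power2_eq_square mult_le_cancel_right)
     (metis norm_ge_zero order.trans norm_eq_zero not_less)
qed

lemma linear_orth_proj:
  assumes S: "subspace S"
  shows "linear (orth_proj S)"
proof -
  have eq: "orth_proj S x = y" if "y \<in> S" "x - y \<in> S\<^sup>\<bottom>" for x y
    using orth_proj_ex1[OF S, of x] orth_proj_in[OF S] orth_proj_diff[OF S] that by blast
  note S' = subspace_orthogonal_comp[of S]
  show ?thesis
  proof
    fix x y
    have "x + y - (orth_proj S x + orth_proj S y) \<in> S\<^sup>\<bottom>"
      using subspace_add[OF S' orth_proj_diff[OF S, of x] orth_proj_diff[OF S, of y]]
      by (simp add: algebra_simps)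
    then show "orth_proj S (x + y) = orth_proj S x + orth_proj S y"
      by (intro eq subspace_add S orth_proj_in)
  next
    fix c :: real and x
    have "c *\<^sub>R x - c *\<^sub>R orth_proj S x \<in> S\<^sup>\<bottom>"
      using subspace_scale[OF S' orth_proj_diff[OF S, of x]] by (simp add: algebra_simps)
    then show "orth_proj S (c *\<^sub>R x) = c *\<^sub>R orth_proj S x"
      by (intro eq subspace_scale S orth_proj_in)
  qed
qed

text \<open>
  The sum over a skew-diagonal is the inner product with the Hankel matrix \<open>H\<close> that is \<open>1\<close> on
  this skew-diagonal and \<open>0\<close> elsewhere, and this inner product sees only the Hankel part.
\<close>

lemma skew_sum_le_orth_proj_hankel:
  fixes A :: "real^'n^'n" and idx :: "'n::finite \<Rightarrow> nat"
  shows "(\<Sum>(i, j)\<in>skew_diagonal idx m. A $ i $ j)\<^sup>2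
           \<le> real CARD('n \<times> 'n) * (norm (orth_proj (hankel idx) A))\<^sup>2"
proof -
  define H :: "real^'n^'n" where "H = (\<chi> i j. if idx i + idx j = m then 1 else 0)"
  have H: "H \<in> hankel idx" by (auto simp: hankel_def H_def)
  have inner_H: "A \<bullet> H = (\<Sum>(i, j)\<in>skew_diagonal idx m. A $ i $ j)" for A :: "real^'n^'n"
  proof -
    have "A \<bullet> H = (\<Sum>i\<in>UNIV. \<Sum>j\<in>UNIV. if idx i + idx j = m then A $ i $ j else 0)"
      by (simp add: inner_vec_def H_def if_distrib cong: if_cong)
    also have "\<dots> = (\<Sum>p\<in>UNIV. if p \<in> skew_diagonal idx m then A $ fst p $ snd p else 0)"
      unfolding UNIV_Times_UNIV[symmetric] sum.cartesian_product
      by (intro sum.cong) (auto simp: skew_diagonal_def)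
    also have "\<dots> = (\<Sum>p\<in>skew_diagonal idx m. A $ fst p $ snd p)"
      by (simp add: sum.If_cases)
    finally show ?thesis by (simp add: case_prod_unfold)
  qed
  have "H \<bullet> H = real (card (skew_diagonal idx m))"
    unfolding inner_H by (simp add: H_def skew_diagonal_def case_prod_unfold)
  then have norm_H: "(norm H)\<^sup>2 \<le> real CARD('n \<times> 'n)"
    using of_nat_mono[OF card_mono[of UNIV "skew_diagonal idx m"]] by (simp add: power2_norm_eq_inner)
  have "(\<Sum>(i, j)\<in>skew_diagonal idx m. A $ i $ j)\<^sup>2 = (orth_proj (hankel idx) A \<bullet> H)\<^sup>2"
    using inner_orth_proj[OF subspace_hankel H] inner_H by simp
  also have "\<dots> \<le> (norm H)\<^sup>2 * (norm (orth_proj (hankel idx) A))\<^sup>2"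
    using Cauchy_Schwarz_ineq[of "orth_proj (hankel idx) A" H]
    by (simp add: power2_norm_eq_inner mult.commute)
  also have "\<dots> \<le> real CARD('n \<times> 'n) * (norm (orth_proj (hankel idx) A))\<^sup>2"
    by (intro mult_right_mono norm_H) auto
  finally show ?thesis .
qed

lemma jacobian_entry: "jacobian u (at x) $ i $ j = frechet_derivative u (at x) (axis j 1) $ i"
  by (simp add: jacobian_def matrix_def)

lemma C1_compact_component:
  fixes u :: "real^'n \<Rightarrow> real^'n"
  assumes "u \<in> smooth_compact_support"
  shows "C1_compact (\<lambda>x. u x $ i) (\<lambda>x v. frechet_derivative u (at x) v $ i)"
proof -
  have "C_diff (Suc 0) u" and K: "compact (closure {x. u x \<noteq> 0})"
    using assms unfolding smooth_compact_support_def by blast+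
  then have diff: "u differentiable (at x)"
    and cont: "continuous_on UNIV (\<lambda>x. frechet_derivative u (at x) v)" for x v
    by auto
  have "((\<lambda>x. u x $ i) has_derivative (\<lambda>v. frechet_derivative u (at x) v $ i)) (at x)" for x
    using bounded_linear.has_derivative[OF bounded_linear_vec_nth] diff frechet_derivative_works by blast
  moreover have "continuous_on UNIV (\<lambda>x. frechet_derivative u (at x) v $ i)" for v
    by (intro continuous_on_component cont)
  moreover have "{x. u x $ i \<noteq> 0} \<subseteq> closure {x. u x \<noteq> 0}"
    by (rule order.trans[OF _ closure_subset]) auto
  ultimately show ?thesis
    unfolding C1_compact_def using compact_imp_bounded[OF K] bounded_subset by blast
qed

lemma C1_compact_integrable_deriv_mult:
  assumes f: "C1_compact f f'" and g: "C1_compact g g'"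
  shows "integrable lborel (\<lambda>x. f' x v * g' x w)"
proof (rule integrable_continuous_bounded_support)
  show "continuous_on UNIV (\<lambda>x. f' x v * g' x w)"
    using f g unfolding C1_compact_def by (intro continuous_intros) auto
  show "bounded {x. f' x v * g' x w \<noteq> 0}"
    by (rule bounded_subset[OF C1_compact_deriv_bounded_support[OF f]]) auto
qed

text \<open>The pointwise source of the weighted Cauchy-Schwarz inequality for integrals.\<close>

lemma mult_le_weighted_squares:
  fixes x y \<delta> :: real
  assumes "0 < \<delta>"
  shows "\<bar>x * y\<bar> \<le> \<delta> * (x * x) + (y * y) / \<delta>"
proof -
  have "0 \<le> (\<delta> * \<bar>x\<bar> - \<bar>y\<bar>)\<^sup>2 / \<delta>" using assms by simp
  also have "\<dots> = \<delta> * (x * x) + (y * y) / \<delta> - 2 * \<bar>x * y\<bar>"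
    using assms by (simp add: power2_diff power2_eq_square abs_mult field_simps)
  finally show ?thesis using abs_ge_zero[of "x * y"] by linarith
qed

text \<open>
  The link between the two previous parts: gradients satisfy the hypotheses of
  \<open>total_energy_estimate\<close> with \<open>S\<close> a multiple of the energy of the Hankel part.
\<close>

lemma gradient_energy_skew_controlled:
  fixes u :: "real^'n \<Rightarrow> real^'n" and idx :: "'n::finite \<Rightarrow> nat"
  assumes u: "u \<in> smooth_compact_support"
    and int: "integrable lborel (\<lambda>x. (norm (orth_proj (hankel idx) (jacobian u (at x))))\<^sup>2)"
  shows "skew_controlled idx
      (\<lambda>p q. \<integral>x. jacobian u (at x) $ fst p $ snd p * jacobian u (at x) $ fst q $ snd q \<partial>lborel)
      (real CARD('n \<times> 'n) * (\<integral>x. (norm (orth_proj (hankel idx) (jacobian u (at x))))\<^sup>2 \<partial>lborel))"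
proof -
  define D where "D p x = jacobian u (at x) $ fst p $ snd p" for p x
  define B where "B p q = (\<integral>x. D p x * D q x \<partial>lborel)" for p q
  let ?P = "\<lambda>x. orth_proj (hankel idx) (jacobian u (at x))"
  let ?S = "real CARD('n \<times> 'n) * (\<integral>x. (norm (?P x))\<^sup>2 \<partial>lborel)"
  have DD: "integrable lborel (\<lambda>x. D p x * D q x)" for p q
    unfolding D_def jacobian_entry
    by (rule C1_compact_integrable_deriv_mult[OF C1_compact_component[OF u] C1_compact_component[OF u]])
  have swap: "B (i, j) (k, l) = B (i, l) (k, j)" for i j k l
    unfolding B_def D_def jacobian_entry fst_conv snd_conv
    by (rule integral_deriv_swap[OF C1_compact_component[OF u] C1_compact_component[OF u]])
  have CS: "\<bar>B p q\<bar> \<le> \<delta> * B p p + B q q / \<delta>" if "0 < \<delta>" for p q \<delta>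
  proof -
    have "\<bar>B p q\<bar> \<le> (\<integral>x. \<bar>D p x * D q x\<bar> \<partial>lborel)"
      unfolding B_def by (rule integral_abs_bound)
    also have "\<dots> \<le> (\<integral>x. \<delta> * (D p x * D p x) + (D q x * D q x) / \<delta> \<partial>lborel)"
      by (intro integral_mono integrable_abs Bochner_Integration.integrable_add
          integrable_mult_right integrable_divide DD mult_le_weighted_squares that)
    also have "\<dots> = \<delta> * B p p + B q q / \<delta>"
      unfolding B_def by (simp add: DD)
    finally show ?thesis .
  qed
  have skew: "(\<Sum>p\<in>skew_diagonal idx m. \<Sum>q\<in>skew_diagonal idx m. B p q) \<le> ?S" for m
  proof -
    have "(\<Sum>p\<in>skew_diagonal idx m. \<Sum>q\<in>skew_diagonal idx m. B p q)
        = (\<integral>x. (\<Sum>p\<in>skew_diagonal idx m. \<Sum>q\<in>skew_diagonal idx m. D p x * D q x) \<partial>lborel)"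
      unfolding B_def by (simp add: Bochner_Integration.integral_sum DD)
    also have "\<dots> = (\<integral>x. (\<Sum>p\<in>skew_diagonal idx m. D p x)\<^sup>2 \<partial>lborel)"
      by (simp add: power2_eq_square sum_product)
    also have "\<dots> \<le> (\<integral>x. real CARD('n \<times> 'n) * (norm (?P x))\<^sup>2 \<partial>lborel)"
      using skew_sum_le_orth_proj_hankel[where idx=idx and m=m]
      by (intro integral_mono' integrable_mult_right int) (auto simp: D_def case_prod_unfold)
    finally show ?thesis by simp
  qed
  have "skew_controlled idx B ?S"
    unfolding skew_controlled_def using swap CS skew by (auto simp: B_def)
  then show ?thesis unfolding B_def D_def .
qed

lemma norm_matrix_square:
  fixes A :: "real^'n^'n"
  shows "(norm A)\<^sup>2 = (\<Sum>p\<in>UNIV. A $ fst p $ snd p * A $ fst p $ snd p)"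
  unfolding power2_norm_eq_inner inner_vec_def inner_real_def UNIV_Times_UNIV[symmetric]
    sum.cartesian_product by (simp add: case_prod_unfold)

lemma integrable_norm_orth_proj_jacobian:
  fixes u :: "real^'n \<Rightarrow> real^'n" and S :: "(real^'n^'n) set"
  assumes u: "u \<in> smooth_compact_support" and S: "subspace S"
  shows "integrable lborel (\<lambda>x. (norm (orth_proj S (jacobian u (at x))))\<^sup>2)"
proof (rule integrable_continuous_bounded_support)
  let ?J = "\<lambda>x. jacobian u (at x)"
  have "continuous_on UNIV (\<lambda>x. ?J x $ i $ j)" for i j
    using C1_compact_component[OF u, of i] unfolding C1_compact_def jacobian_entry by blast
  then have "continuous_on UNIV (\<lambda>x. \<chi> i j. ?J x $ i $ j)"
    by (intro continuous_on_vec_lambda)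
  then have "continuous_on UNIV ?J" by simp
  then have "continuous_on UNIV (\<lambda>x. orth_proj S (?J x))"
    by (rule linear_continuous_on_compose) (rule linear_orth_proj[OF S])
  then show "continuous_on UNIV (\<lambda>x. (norm (orth_proj S (?J x)))\<^sup>2)"
    by (intro continuous_on_power continuous_on_norm)
  have "bounded {x. ?J x $ i $ j \<noteq> 0}" for i j
    unfolding jacobian_entry by (rule C1_compact_deriv_bounded_support[OF C1_compact_component[OF u]])
  then have "bounded (\<Union>i. \<Union>j. {x. ?J x $ i $ j \<noteq> 0})" by (intro bounded_UN) auto
  moreover have "{x. (norm (orth_proj S (?J x)))\<^sup>2 \<noteq> 0} \<subseteq> (\<Union>i. \<Union>j. {x. ?J x $ i $ j \<noteq> 0})"
    using linear_0[OF linear_orth_proj[OF S]] by (auto simp: vec_eq_iff) (metis vec_eq_iff zero_index)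
  ultimately show "bounded {x. (norm (orth_proj S (?J x)))\<^sup>2 \<noteq> 0}" by (rule bounded_subset)
qed

theorem theorem3p4:
  shows "\<exists>C::real. \<forall>idx :: 'n::finite \<Rightarrow> nat. bij_betw idx UNIV {1..CARD('n)} \<longrightarrow>
    (\<forall>u :: real^'n \<Rightarrow> real^'n. u \<in> smooth_compact_support \<longrightarrow>
      L2_norm (\<lambda>x. orth_proj ((hankel idx)\<^sup>\<bottom>) (jacobian u (at x)))
        \<le> C * L2_norm (\<lambda>x. orth_proj (hankel idx) (jacobian u (at x))))"
proof -
  let ?N = "real CARD('n \<times> 'n)"
  obtain C where C: "0 \<le> C" and est: "\<And>(idx::'n \<Rightarrow> nat) B S. bij_betw idx UNIV {1..CARD('n)} \<Longrightarrow>
      skew_controlled idx B S \<Longrightarrow> (\<Sum>p\<in>UNIV. B p p) \<le> C * S"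
    using total_energy_estimate[where 'n='n] by blast
  have "L2_norm (\<lambda>x. orth_proj ((hankel idx)\<^sup>\<bottom>) (jacobian u (at x)))
      \<le> sqrt (C * ?N) * L2_norm (\<lambda>x. orth_proj (hankel idx) (jacobian u (at x)))"
    if idx: "bij_betw idx UNIV {1..CARD('n)}" and u: "u \<in> smooth_compact_support"
    for idx :: "'n \<Rightarrow> nat" and u :: "real^'n \<Rightarrow> real^'n"
  proof -
    define D where "D p x = jacobian u (at x) $ fst p $ snd p" for p x
    have DD: "integrable lborel (\<lambda>x. D p x * D p x)" for p
      unfolding D_def jacobian_entry
      by (rule C1_compact_integrable_deriv_mult[OF C1_compact_component[OF u] C1_compact_component[OF u]])
    have "(\<integral>x. (norm (orth_proj ((hankel idx)\<^sup>\<bottom>) (jacobian u (at x))))\<^sup>2 \<partial>lborel)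
        \<le> (\<integral>x. (\<Sum>p\<in>UNIV. D p x * D p x) \<partial>lborel)"
    proof (rule integral_mono')
      show "(norm (orth_proj ((hankel idx)\<^sup>\<bottom>) (jacobian u (at x))))\<^sup>2 \<le> (\<Sum>p\<in>UNIV. D p x * D p x)" for x
        using norm_orth_proj_le[OF subspace_orthogonal_comp, of "hankel idx" "jacobian u (at x)"]
        unfolding D_def norm_matrix_square[symmetric] by (intro power_mono) auto
    qed (auto intro!: sum_nonneg DD Bochner_Integration.integrable_sum)
    also have "\<dots> = (\<Sum>p\<in>UNIV. \<integral>x. D p x * D p x \<partial>lborel)"
      by (rule Bochner_Integration.integral_sum) (rule DD)
    also have "\<dots> \<le> C * (?N * (\<integral>x. (norm (orth_proj (hankel idx) (jacobian u (at x))))\<^sup>2 \<partial>lborel))"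
      unfolding D_def
      by (rule est[OF idx gradient_energy_skew_controlled[OF u
            integrable_norm_orth_proj_jacobian[OF u subspace_hankel]]])
    finally show ?thesis
      unfolding L2_norm_def real_sqrt_mult[symmetric] mult.assoc by (rule real_sqrt_le_mono)
  qed
  then show ?thesis by blast
qed

end
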